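(* Let $V \ge 1$ be an integer and let $x = (x_1,\dots,x_V) \in \mathbb{R}^V$. Let the sequences $(m_j)_{0\le j\le V}$ and $(d_j)_{0\le j\le V}$ be those computed by the following procedure: $m_0 = -\infty$, $d_0 = 0$, and for $j = 1,\dots,V$ (in this order) $$m_j = \max(m_{j-1}, x_j), \qquad d_j = d_{j-1}\cdot e^{m_{j-1}-m_j} + e^{x_j - m_j}.$$ Then the final values satisfy $$m_V = \max_{1\le k\le V} x_k \qquad\text{and}\qquad d_V = \sum_{j=1}^{V} e^{x_j - m_V}.$$
   Context: The procedure is the single-pass online computation of the maximum and of the normalization term of the numerically safe form of softmax, $y_i = e^{x_i - \max_k x_k} / \sum_{j=1}^V e^{x_j - \max_k x_k}$. Arithmetic is exact real arithmetic, with the initial value $m_0=-\infty$ handled by the usual extended-real conventions: $\max(-\infty, a) = a$, $-\infty - a = -\infty$ for real $a$, and $e^{-\infty} = 0$ (so the first term in the update for $d_1$ is $0\cdot 0 = 0$). *)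

theory Defs
  imports Complex_Main "HOL-Library.Extended_Real"
begin

function exp_ereal :: "ereal \<Rightarrow> ereal" where
  "exp_ereal (ereal r) = ereal (exp r)"
| "exp_ereal \<infinity> = \<infinity>"
| "exp_ereal (-\<infinity>) = 0"
  by (auto intro: ereal_cases)
termination by (relation "{}") simp

end

(* The invariant of the loop is the claim for every prefix of x. Passing from the maximum a to the
   maximum b multiplies each summand exp (x j - a) by exp (a - b), which is exactly the update of d.
   After the first step all values are finite, so the invariant lives in the reals. *)
theory Submission
  imports Defs
begin

theorem theorem1:
  fixes V :: nat and x :: "nat \<Rightarrow> real" and m d :: "nat \<Rightarrow> ereal"
  assumes "V \<ge> 1"
    and "m 0 = -\<infinity>" and "d 0 = 0"
    and "\<And>j. j \<in> {1..V} \<Longrightarrow> m j = max (m (j - 1)) (ereal (x j))"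
    and "\<And>j. j \<in> {1..V} \<Longrightarrow>
           d j = d (j - 1) * exp_ereal (m (j - 1) - m j) + exp_ereal (ereal (x j) - m j)"
  shows "m V = ereal (Max (x ` {1..V})) \<and>
         d V = (\<Sum>j=1..V. exp_ereal (ereal (x j) - m V))"
proof -
  define M where "M n = Max (x ` {1..n})" for n
  \<comment> \<open>The range starts at 1 because \<open>m 0\<close> is infinite and
    \<open>M 0\<close> is the \<open>Max\<close> of an empty set.\<close>
  have inv: "m n = ereal (M n) \<and> d n = ereal (\<Sum>j=1..n. exp (x j - M n))"
    if "1 \<le> n" "n \<le> V" for n
    using that
  proof (induction n rule: nat_induct_at_least)
    case base
    then have m1: "m 1 = ereal (x 1)"
      using assms(2) assms(4)[of 1] by simp
    \<comment> \<open>The exponent \<open>m 0 - m 1\<close> is \<open>-\<infinity>\<close>, so the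
      first summand of the update is \<open>0 * 0\<close>; the second is
      \<open>exp 0\<close>.\<close>
    with base show ?case
      using assms(2,3) assms(5)[of 1] by (simp add: M_def zero_ereal_def)
  next
    case (Suc n)
    then have m: "m n = ereal (M n)" and d: "d n = ereal (\<Sum>j=1..n. exp (x j - M n))"
      by auto
    \<comment> \<open>\<open>1 \<le> n\<close> keeps \<open>{1..n}\<close> nonempty, so
      \<open>Max\<close> splits off the new element.\<close>
    have M: "M (Suc n) = max (M n) (x (Suc n))"
      using Suc.hyps by (simp add: M_def atLeastAtMostSuc_conv max.commute)
    have m': "m (Suc n) = ereal (M (Suc n))"
      using assms(4)[of "Suc n"] Suc.prems m M by simp
    have "(\<Sum>j=1..n. exp (x j - M n)) * exp (M n - M (Suc n)) = (\<Sum>j=1..n. exp (x j - M (Suc n)))"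
      by (simp add: sum_distrib_right flip: exp_add)
    then show ?case
      using assms(5)[of "Suc n"] Suc.prems m m' d by simp
  qed
  \<comment> \<open>As \<open>m V\<close> is real, the \<open>ereal\<close> sum is the embedded real
    sum of the invariant.\<close>
  show ?thesis
    using inv[of V] assms(1) by (simp add: M_def)
qed

end
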